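(* Let $\Gamma=(V,E)$ be an infinite weighted graph without self-loops (i.e. $\mu_{xx}=0$ for all $x\in V$) and let $\Omega\subset V$ be a finite, connected subset with at least two vertices. Then $\frac12\bigl(1-h(\Omega)\bigr)\le \bar h(\Omega)$.
   Context: $\Gamma=(V,E)$ is a locally finite, connected graph with infinitely many vertices, equipped with symmetric edge weights $\mu_{xy}=\mu_{yx}\ge 0$, where $\mu_{xy}>0$ iff $(x,y)\in E$. Put $\mu(x)=\sum_{y\in V}\mu_{xy}$. For finite $U\subset V$: $\mathrm{vol}(U)=\sum_{x\in U}\mu(x)$, $|\partial U|=\sum_{x\in U}\sum_{y\notin U}\mu_{xy}$; for finite $V_1,V_2\subset V$: $|E(V_1,V_2)|=\sum_{x\in V_1}\sum_{y\in V_2}\mu_{xy}$. A subset is connected if the subgraph of $\Gamma$ it induces is connected. Cheeger constant: $h(\Omega)=\inf\{|\partial U|/\mathrm{vol}(U):\emptyset\neq U\subset\Omega,\ U\text{ finite}\}$. Dual Cheeger constant: $\bar h(\Omega)=\sup\left\{\frac{2|E(V_1,V_2)|}{\mathrm{vol}(V_1)+\mathrm{vol}(V_2)}\right\}$, supremum over pairs of disjoint nonempty finite subsets $V_1,V_2\subset\Omega$. *)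

theory Defs
  imports "HOL-Analysis.Infinite_Sum" "Graph_Theory.Digraph_Component"
begin

text \<open>
  An undirected graph is a symmetric digraph without parallel arcs, with vertex set
  \<open>pverts G\<close> and edge relation \<open>parcs G\<close>; the locale \<open>pair_sym_digraph\<close> permits self-loops.
  Nothing is required of the values of \<open>\<mu>\<close> outside \<open>pverts G\<close>.
\<close>

locale infinite_weighted_graph = pair_sym_digraph G
  for G :: "'a pair_pre_digraph" +
  fixes \<mu> :: "'a \<Rightarrow> 'a \<Rightarrow> real"
  assumes infinite_verts: "infinite (pverts G)"
    and locally_finite: "x \<in> pverts G \<Longrightarrow> finite {y \<in> pverts G. (x, y) \<in> parcs G}"
    and connected_graph: "Digraph_Component.connected (with_proj G)"
    and weight_sym: "x \<in> pverts G \<Longrightarrow> y \<in> pverts G \<Longrightarrow> \<mu> x y = \<mu> y x"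
    and weight_nonneg: "x \<in> pverts G \<Longrightarrow> y \<in> pverts G \<Longrightarrow> 0 \<le> \<mu> x y"
    and weight_pos_iff: "x \<in> pverts G \<Longrightarrow> y \<in> pverts G \<Longrightarrow> 0 < \<mu> x y \<longleftrightarrow> (x, y) \<in> parcs G"

definition connected_subset :: "'a pair_pre_digraph \<Rightarrow> 'a set \<Rightarrow> bool" where
  "connected_subset G U \<longleftrightarrow> U \<subseteq> pverts G \<and> Digraph_Component.connected (with_proj G \<restriction> U)"

text \<open>
  By local finiteness, each infinite sum below has only finitely many nonzero terms.
\<close>

definition vertex_weight :: "'a pair_pre_digraph \<Rightarrow> ('a \<Rightarrow> 'a \<Rightarrow> real) \<Rightarrow> 'a \<Rightarrow> real" where
  "vertex_weight G \<mu> x = (\<Sum>\<^sub>\<infinity>y\<in>pverts G. \<mu> x y)"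

definition vol :: "'a pair_pre_digraph \<Rightarrow> ('a \<Rightarrow> 'a \<Rightarrow> real) \<Rightarrow> 'a set \<Rightarrow> real" where
  "vol G \<mu> U = (\<Sum>x\<in>U. vertex_weight G \<mu> x)"

definition boundary_weight :: "'a pair_pre_digraph \<Rightarrow> ('a \<Rightarrow> 'a \<Rightarrow> real) \<Rightarrow> 'a set \<Rightarrow> real" where
  "boundary_weight G \<mu> U = (\<Sum>x\<in>U. \<Sum>\<^sub>\<infinity>y\<in>pverts G - U. \<mu> x y)"

definition edge_weight :: "('a \<Rightarrow> 'a \<Rightarrow> real) \<Rightarrow> 'a set \<Rightarrow> 'a set \<Rightarrow> real" where
  "edge_weight \<mu> V1 V2 = (\<Sum>x\<in>V1. \<Sum>y\<in>V2. \<mu> x y)"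

text \<open>
  In an infinite connected graph every vertex has positive weight, so no denominator
  below vanishes and all quotients lie in \<open>[0, 1]\<close>.  The index set of the infimum is
  nonempty if \<open>\<Omega>\<close> is nonempty, that of the supremum if \<open>\<Omega>\<close> has at least two vertices;
  then \<open>Inf\<close> and \<open>Sup\<close> on the reals are the genuine infimum and supremum.
\<close>

definition cheeger :: "'a pair_pre_digraph \<Rightarrow> ('a \<Rightarrow> 'a \<Rightarrow> real) \<Rightarrow> 'a set \<Rightarrow> real" where
  "cheeger G \<mu> \<Omega> =
     Inf {boundary_weight G \<mu> U / vol G \<mu> U | U. U \<noteq> {} \<and> U \<subseteq> \<Omega> \<and> finite U}"

definition dual_cheeger :: "'a pair_pre_digraph \<Rightarrow> ('a \<Rightarrow> 'a \<Rightarrow> real) \<Rightarrow> 'a set \<Rightarrow> real" where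
  "dual_cheeger G \<mu> \<Omega> =
     Sup {2 * edge_weight \<mu> V1 V2 / (vol G \<mu> V1 + vol G \<mu> V2) | V1 V2.
            V1 \<noteq> {} \<and> V2 \<noteq> {} \<and> V1 \<inter> V2 = {} \<and> V1 \<subseteq> \<Omega> \<and> V2 \<subseteq> \<Omega> \<and> finite V1 \<and> finite V2}"

end

theory Submission
  imports Defs
begin

text \<open>
  Every finite \<open>U\<close> satisfies \<open>vol U = |\<partial>U| + w(U)\<close>, where \<open>w(U) = |E(U, U)|\<close> counts each inner
  edge twice; hence \<open>1 - |\<partial>U| / vol U = w(U) / vol U\<close>.  A graph without loops has a cut that
  carries at least half of its total edge weight (\<open>max_cut_at_least_half\<close>), so \<open>U\<close> splits into
  \<open>V\<^sub>1\<close> and \<open>V\<^sub>2\<close> with \<open>2 |E(V\<^sub>1, V\<^sub>2)| \<ge> w(U) / 2\<close>.  Since \<open>vol V\<^sub>1 + vol V\<^sub>2 = vol U\<close>, the pair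
  \<open>(V\<^sub>1, V\<^sub>2)\<close> shows that the dual Cheeger constant is at least \<open>(1 - |\<partial>U| / vol U) / 2\<close>, and it
  remains to take the infimum over \<open>U\<close>.

  The pair is admissible only if both parts are nonempty.  This is automatic when \<open>w(U) > 0\<close>; when
  \<open>w(U) = 0\<close>, for instance for a single vertex, the bound to be shown is just that the dual Cheeger
  constant is nonnegative, and any two distinct vertices of \<open>\<Omega>\<close> witness that.
\<close>

text \<open>
  The cut is built greedily: each new vertex \<open>x\<close> joins the side to which it is less strongly tied,
  so that at least half of the weight between \<open>x\<close> and the earlier vertices crosses the cut.
  The factor \<open>4\<close> is \<open>2\<close> for the half and \<open>2\<close> because \<open>edge_weight \<mu> U U\<close> counts every edge twice.
\<close>
lemma max_cut_at_least_half:
  assumes "finite U"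
    and "\<And>x y. x \<in> U \<Longrightarrow> y \<in> U \<Longrightarrow> \<mu> x y = \<mu> y x"
    and "\<And>x. x \<in> U \<Longrightarrow> \<mu> x x = 0"
  obtains A where "A \<subseteq> U" and "edge_weight \<mu> U U \<le> 4 * edge_weight \<mu> A (U - A)"
proof -
  have "\<exists>A\<subseteq>U. edge_weight \<mu> U U \<le> 4 * edge_weight \<mu> A (U - A)"
    using assms
  proof (induction U rule: finite_induct)
    case empty
    then show ?case by (simp add: edge_weight_def)
  next
    case (insert x U)
    then obtain A where A: "A \<subseteq> U" "edge_weight \<mu> U U \<le> 4 * edge_weight \<mu> A (U - A)"
      by auto
    define B where "B = U - A"
    have fin: "finite A" "finite B" "x \<notin> A" "x \<notin> B" and U: "U = A \<union> B" "A \<inter> B = {}"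
      using A insert.hyps finite_subset by (auto simp: B_def)
    have sym: "(\<Sum>y\<in>S. \<mu> y x) = (\<Sum>y\<in>S. \<mu> x y)" if "S \<subseteq> U" for S
      using that insert.prems by (intro sum.cong) auto
    have total: "edge_weight \<mu> (insert x U) (insert x U)
        = edge_weight \<mu> U U + 2 * ((\<Sum>y\<in>A. \<mu> x y) + (\<Sum>y\<in>B. \<mu> x y))"
      using insert.hyps insert.prems fin U sym[of U]
      by (simp add: edge_weight_def sum.distrib sum.union_disjoint)
    show ?case
    proof (cases "(\<Sum>y\<in>A. \<mu> x y) \<le> (\<Sum>y\<in>B. \<mu> x y)")
      case True
      have "insert x U - insert x A = B"
        using insert.hyps by (auto simp: B_def)
      moreover have "edge_weight \<mu> (insert x A) B = edge_weight \<mu> A B + (\<Sum>y\<in>B. \<mu> x y)"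
        using fin by (simp add: edge_weight_def)
      ultimately have "edge_weight \<mu> (insert x U) (insert x U)
          \<le> 4 * edge_weight \<mu> (insert x A) (insert x U - insert x A)"
        using total A(2) True by (simp add: B_def)
      then show ?thesis
        using A(1) by blast
    next
      case False
      have "insert x U - A = insert x B"
        using fin by (auto simp: B_def)
      moreover have "edge_weight \<mu> A (insert x B) = edge_weight \<mu> A B + (\<Sum>y\<in>A. \<mu> x y)"
        using fin sym[OF A(1)] by (simp add: edge_weight_def sum.distrib)
      ultimately have "edge_weight \<mu> (insert x U) (insert x U)
          \<le> 4 * edge_weight \<mu> A (insert x U - A)"
        using total A(2) False by (simp add: B_def)
      then show ?thesis
        using A(1) by blast
    qed
  qed
  then show thesis
    using that by blast
qed

context infinite_weighted_graph
begin

lemma weight_eq_0_iff: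
  assumes "x \<in> pverts G" and "y \<in> pverts G"
  shows "\<mu> x y = 0 \<longleftrightarrow> (x, y) \<notin> parcs G"
  using weight_nonneg[OF assms] weight_pos_iff[OF assms] by auto

lemma weights_summable:
  assumes "x \<in> pverts G" and "A \<subseteq> pverts G"
  shows "\<mu> x summable_on A"
proof (rule finite_nonzero_values_imp_summable_on)
  show "finite {y \<in> A. \<mu> x y \<noteq> 0}"
    using assms
    by (intro finite_subset[OF _ locally_finite[OF assms(1)]]) (auto simp: weight_eq_0_iff)
qed

text \<open>
  In an infinite connected graph no vertex is isolated; this keeps the denominators of the Cheeger
  quotients away from \<open>0\<close>.
\<close>
lemma vertex_weight_pos:
  assumes x: "x \<in> pverts G"
  shows "0 < vertex_weight G \<mu> x"
proof -
  obtain z where z: "z \<in> pverts G" "z \<noteq> x"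
    using infinite_verts finite_subset[of "pverts G" "{x}"] by auto
  have "strongly_connected (with_proj G)"
    using connected_graph symmetric_connected_imp_strongly_connected sym_arcs by blast
  then have "x \<rightarrow>\<^sup>*\<^bsub>with_proj G\<^esub> z"
    using x z by (auto simp: strongly_connected_def)
  then obtain y where "(x, y) \<in> parcs G"
    using z(2) by (cases rule: converse_reachable_cases) auto
  then have y: "y \<in> pverts G" "0 < \<mu> x y"
    using x weight_pos_iff in_arcsD2 by auto
  have "\<mu> x y = infsum (\<mu> x) {y}"
    by simp
  also have "\<dots> \<le> vertex_weight G \<mu> x"
    unfolding vertex_weight_def using x y(1) weight_nonneg
    by (intro infsum_mono_neutral weights_summable) auto
  finally show ?thesis
    using y(2) by simp
qed

lemma vol_pos:
  assumes "finite U" and "U \<noteq> {}" and "U \<subseteq> pverts G"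
  shows "0 < vol G \<mu> U"
  unfolding vol_def using assms vertex_weight_pos by (intro sum_pos) auto

lemma edge_weight_nonneg:
  assumes "A \<subseteq> pverts G" and "B \<subseteq> pverts G"
  shows "0 \<le> edge_weight \<mu> A B"
  unfolding edge_weight_def using assms weight_nonneg by (intro sum_nonneg) auto

lemma vol_eq_boundary_plus_inner:
  assumes "finite U" and "U \<subseteq> pverts G"
  shows "vol G \<mu> U = boundary_weight G \<mu> U + edge_weight \<mu> U U"
proof -
  have "vertex_weight G \<mu> x = infsum (\<mu> x) (pverts G - U) + (\<Sum>y\<in>U. \<mu> x y)" if "x \<in> U" for x
  proof -
    have "vertex_weight G \<mu> x = infsum (\<mu> x) ((pverts G - U) \<union> U)"
      using assms(2) by (simp add: vertex_weight_def Un_absorb2)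
    also have "\<dots> = infsum (\<mu> x) (pverts G - U) + infsum (\<mu> x) U"
      using that assms(2) by (intro infsum_Un_disjoint weights_summable) auto
    finally show ?thesis
      using assms(1) by simp
  qed
  then show ?thesis
    by (simp add: vol_def boundary_weight_def edge_weight_def sum.distrib)
qed

lemma dual_cheeger_upper:
  assumes "finite \<Omega>" and "V1 \<noteq> {}" "V2 \<noteq> {}" "V1 \<inter> V2 = {}" "V1 \<subseteq> \<Omega>" "V2 \<subseteq> \<Omega>"
  shows "2 * edge_weight \<mu> V1 V2 / (vol G \<mu> V1 + vol G \<mu> V2) \<le> dual_cheeger G \<mu> \<Omega>"
  unfolding dual_cheeger_def
proof (rule cSup_upper)
  show "2 * edge_weight \<mu> V1 V2 / (vol G \<mu> V1 + vol G \<mu> V2)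
      \<in> {2 * edge_weight \<mu> V1 V2 / (vol G \<mu> V1 + vol G \<mu> V2) | V1 V2.
          V1 \<noteq> {} \<and> V2 \<noteq> {} \<and> V1 \<inter> V2 = {} \<and> V1 \<subseteq> \<Omega> \<and> V2 \<subseteq> \<Omega> \<and> finite V1 \<and> finite V2}"
    using assms finite_subset[OF _ assms(1)]
    by (intro CollectI exI[of _ V1] exI[of _ V2]) simp
  \<comment> \<open>A finite \<open>\<Omega>\<close> has only finitely many pairs of subsets.\<close>
  have "finite ((\<lambda>(V1, V2). 2 * edge_weight \<mu> V1 V2 / (vol G \<mu> V1 + vol G \<mu> V2))
      ` (Pow \<Omega> \<times> Pow \<Omega>))"
    using assms(1) by simp
  then show "bdd_above {2 * edge_weight \<mu> V1 V2 / (vol G \<mu> V1 + vol G \<mu> V2) | V1 V2.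
      V1 \<noteq> {} \<and> V2 \<noteq> {} \<and> V1 \<inter> V2 = {} \<and> V1 \<subseteq> \<Omega> \<and> V2 \<subseteq> \<Omega> \<and> finite V1 \<and> finite V2}"
    by (intro bdd_above_finite) (erule finite_subset[rotated], auto)
qed

lemma dual_cheeger_nonneg:
  assumes "finite \<Omega>" and "\<Omega> \<subseteq> pverts G" and "2 \<le> card \<Omega>"
  shows "0 \<le> dual_cheeger G \<mu> \<Omega>"
proof -
  obtain a where a: "a \<in> \<Omega>"
    using assms(3) by fastforce
  have "\<Omega> - {a} \<noteq> {}"
    using assms(3) card_mono[of "{a}" \<Omega>] by auto
  then obtain b where b: "b \<in> \<Omega>" "b \<noteq> a"
    by blast
  have "0 \<le> 2 * edge_weight \<mu> {a} {b} / (vol G \<mu> {a} + vol G \<mu> {b})"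
    using a b assms(2) vol_pos[of "{a}"] vol_pos[of "{b}"] edge_weight_nonneg[of "{a}" "{b}"]
    by (simp add: subset_iff)
  also have "\<dots> \<le> dual_cheeger G \<mu> \<Omega>"
    using a b by (intro dual_cheeger_upper assms(1)) auto
  finally show ?thesis .
qed

lemma cheeger_quotient_le_dual_cheeger:
  assumes no_loops: "\<And>x. x \<in> pverts G \<Longrightarrow> \<mu> x x = 0"
    and \<Omega>: "finite \<Omega>" "\<Omega> \<subseteq> pverts G" "2 \<le> card \<Omega>"
    and U: "U \<noteq> {}" "U \<subseteq> \<Omega>"
  shows "1 / 2 * (1 - boundary_weight G \<mu> U / vol G \<mu> U) \<le> dual_cheeger G \<mu> \<Omega>"
proof -
  have fin: "finite U" and sub: "U \<subseteq> pverts G"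
    using \<Omega> U finite_subset by auto
  have vol: "0 < vol G \<mu> U"
    using vol_pos fin U(1) sub by blast
  have quotient: "1 / 2 * (1 - boundary_weight G \<mu> U / vol G \<mu> U)
      = edge_weight \<mu> U U / 2 / vol G \<mu> U"
    using vol vol_eq_boundary_plus_inner[OF fin sub] by (simp add: field_simps)
  show ?thesis
  proof (cases "edge_weight \<mu> U U = 0")
    case True
    then show ?thesis
      using quotient dual_cheeger_nonneg[OF \<Omega>] by simp
  next
    case False
    then have pos: "0 < edge_weight \<mu> U U"
      using edge_weight_nonneg[OF sub sub] by simp
    obtain A where A: "A \<subseteq> U" and cut: "edge_weight \<mu> U U \<le> 4 * edge_weight \<mu> A (U - A)"
    proof (rule max_cut_at_least_half)
      show "finite U" by (rule fin)
      show "\<mu> x y = \<mu> y x" if "x \<in> U" "y \<in> U" for x y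
        using that sub by (intro weight_sym) auto
      show "\<mu> x x = 0" if "x \<in> U" for x
        using that sub by (intro no_loops) auto
    qed
    have "edge_weight \<mu> A (U - A) \<noteq> 0"
      using pos cut by linarith
    then have "A \<noteq> {}" and "U - A \<noteq> {}"
      by (rule contrapos_nn, simp only: edge_weight_def sum.empty sum.neutral_const)+
    moreover have "vol G \<mu> A + vol G \<mu> (U - A) = vol G \<mu> U"
      using sum.subset_diff[OF A fin, of "vertex_weight G \<mu>"] by (simp add: vol_def)
    ultimately have "2 * edge_weight \<mu> A (U - A) / vol G \<mu> U \<le> dual_cheeger G \<mu> \<Omega>"
      using dual_cheeger_upper[OF \<Omega>(1), of A "U - A"] A U(2) by auto
    moreover have "edge_weight \<mu> U U / 2 / vol G \<mu> U \<le> 2 * edge_weight \<mu> A (U - A) / vol G \<mu> U"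
      using cut vol by (intro divide_right_mono) auto
    ultimately show ?thesis
      using quotient by linarith
  qed
qed

end

theorem theorem4p3:
  fixes G :: "'a pair_pre_digraph" and \<mu> :: "'a \<Rightarrow> 'a \<Rightarrow> real" and \<Omega> :: "'a set"
  assumes "infinite_weighted_graph G \<mu>"
    and "\<forall>x\<in>pverts G. \<mu> x x = 0"
    and "\<Omega> \<subseteq> pverts G" and "finite \<Omega>" and "connected_subset G \<Omega>" and "card \<Omega> \<ge> 2"
  shows "1 / 2 * (1 - cheeger G \<mu> \<Omega>) \<le> dual_cheeger G \<mu> \<Omega>"
proof -
  interpret infinite_weighted_graph G \<mu> by fact
  have "\<Omega> \<noteq> {}"
    using assms(6) by auto
  have "1 - 2 * dual_cheeger G \<mu> \<Omega> \<le> cheeger G \<mu> \<Omega>"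
    unfolding cheeger_def
  proof (rule cInf_greatest)
    show "{boundary_weight G \<mu> U / vol G \<mu> U | U. U \<noteq> {} \<and> U \<subseteq> \<Omega> \<and> finite U} \<noteq> {}"
      using \<open>\<Omega> \<noteq> {}\<close> assms(4) by blast
  next
    fix q
    assume "q \<in> {boundary_weight G \<mu> U / vol G \<mu> U | U. U \<noteq> {} \<and> U \<subseteq> \<Omega> \<and> finite U}"
    then obtain U where "q = boundary_weight G \<mu> U / vol G \<mu> U" "U \<noteq> {}" "U \<subseteq> \<Omega>"
      by blast
    then show "1 - 2 * dual_cheeger G \<mu> \<Omega> \<le> q"
      using cheeger_quotient_le_dual_cheeger[of \<Omega> U] assms by simp
  qed
  then show ?thesis
    by simp
qed

end
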